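(* For every $m\ge 2$, the group $L_m=\langle a,t \mid a^m,\ [t^{i}at^{-i},t^{j}at^{-j}],\ i,j\in\mathbb{Z}\rangle$ has infinitely many cone types with respect to the generating set $\{a,t\}$.
   Context: $L_m$ is the lamplighter group, i.e. the wreath product $\mathbb{Z}_m\wr\mathbb{Z}$, where $a$ generates $\mathbb{Z}_m$ and $t$ generates $\mathbb{Z}$. Let $G$ be a group with the word metric $d$ of a finite generating set $X$. A path $p$ in the Cayley graph is outbound if $d(1,p(s))$ is a strictly increasing function of $s$. The cone at $g\in G$ is the set $C'(g)$ of all outbound paths starting at $g$, and the cone type of $g$ is $C(g)=g^{-1}C'(g)$. (In the discrete setting, paths are edge paths, and $C(g)$ can be identified with the set of words $x_1\cdots x_n$ over $X\cup X^{-1}$ such that $d(1,gx_1\cdots x_i)=d(1,g)+i$ for all $1\le i\le n$.) *)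

theory Defs
  imports Complex_Main "HOL-Algebra.Generated_Groups"
begin

section \<open>Group presentations\<close>

text \<open>A word over \<open>'x\<close> and formal inverses: \<open>(x, True)\<close> stands for the generator \<open>x\<close>
  and \<open>(x, False)\<close> for its inverse.\<close>

type_synonym 'x word = "('x \<times> bool) list"

definition inv_word :: "'x word \<Rightarrow> 'x word" where
  "inv_word w = rev (map (apsnd Not) w)"

definition gen_power :: "'x \<Rightarrow> int \<Rightarrow> 'x word" where
  "gen_power x i = replicate (nat \<bar>i\<bar>) (x, 0 \<le> i)"

definition commutator_word :: "'x word \<Rightarrow> 'x word \<Rightarrow> 'x word" where
  "commutator_word u v = u @ v @ inv_word u @ inv_word v"

inductive pres_eq :: "'x word set \<Rightarrow> 'x word \<Rightarrow> 'x word \<Rightarrow> bool" for R where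
  refl: "pres_eq R u u"
| sym: "pres_eq R u v \<Longrightarrow> pres_eq R v u"
| trans: "pres_eq R u v \<Longrightarrow> pres_eq R v w \<Longrightarrow> pres_eq R u w"
| cancel: "pres_eq R (u @ [(x, b), (x, \<not> b)] @ v) (u @ v)"
| relator: "r \<in> R \<Longrightarrow> pres_eq R (u @ r @ v) (u @ v)"

definition pres_class :: "'x word set \<Rightarrow> 'x word \<Rightarrow> 'x word set" where
  "pres_class R w = {v. pres_eq R w v}"

text \<open>The group presented by all of \<open>'x\<close> as generators and \<open>R\<close> as relators.\<close>

definition presented_group :: "'x word set \<Rightarrow> 'x word set monoid" where
  "presented_group R =
    \<lparr>carrier = range (pres_class R),
     mult = (\<lambda>P Q. {w. \<exists>u\<in>P. \<exists>v\<in>Q. pres_eq R (u @ v) w}),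
     one = pres_class R []\<rparr>"

lemma pres_eq_append:
  assumes "pres_eq R u u'" "pres_eq R v v'"
  shows "pres_eq R (u @ v) (u' @ v')"
proof -
  have left: "pres_eq R (p @ x) (p @ y)" if "pres_eq R x y" for p x y
    using that
  proof induction
    case (cancel u x b v)
    then show ?case using pres_eq.cancel[of R "p @ u" x b v] by simp
  next
    case (relator r u v)
    then show ?case using pres_eq.relator[of r R "p @ u" v] by simp
  qed (blast intro: pres_eq.refl pres_eq.sym pres_eq.trans)+
  have right: "pres_eq R (x @ q) (y @ q)" if "pres_eq R x y" for q x y
    using that
  proof induction
    case (cancel u x b v)
    then show ?case using pres_eq.cancel[of R u x b "v @ q"] by simp
  next
    case (relator r u v)
    then show ?case using pres_eq.relator[of r R u "v @ q"] by simp
  qed (blast intro: pres_eq.refl pres_eq.sym pres_eq.trans)+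
  show ?thesis
    using right[OF assms(1)] left[OF assms(2)] by (rule pres_eq.trans)
qed

lemma pres_class_eq_iff: "pres_class R u = pres_class R v \<longleftrightarrow> pres_eq R u v"
  unfolding pres_class_def
  by (auto intro: pres_eq.refl pres_eq.sym pres_eq.trans)

lemma presented_group_mult [simp]:
  "pres_class R u \<otimes>\<^bsub>presented_group R\<^esub> pres_class R v = pres_class R (u @ v)"
  unfolding presented_group_def pres_class_def
  by (auto intro: pres_eq.refl pres_eq.trans dest: pres_eq_append)

lemma presented_group_one: "\<one>\<^bsub>presented_group R\<^esub> = pres_class R []"
  by (simp add: presented_group_def)

lemma presented_group_carrier: "carrier (presented_group R) = range (pres_class R)"
  by (simp add: presented_group_def)

lemma pres_eq_inv_word: "pres_eq R (inv_word w @ w) []"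
proof (induction w)
  case Nil
  then show ?case by (simp add: inv_word_def pres_eq.refl)
next
  case (Cons y w)
  obtain x b where y: "y = (x, b)" by fastforce
  have "pres_eq R (inv_word w @ [(x, \<not> b), (x, \<not> \<not> b)] @ w) (inv_word w @ w)"
    by (rule pres_eq.cancel)
  then have "pres_eq R (inv_word (y # w) @ y # w) (inv_word w @ w)"
    by (simp add: inv_word_def y)
  then show ?case using Cons.IH by (rule pres_eq.trans)
qed

lemma group_presented_group: "group (presented_group R)"
proof (rule groupI)
  fix P assume "P \<in> carrier (presented_group R)"
  then obtain w where "P = pres_class R w"
    by (auto simp: presented_group_carrier)
  then have "pres_class R (inv_word w) \<otimes>\<^bsub>presented_group R\<^esub> P = \<one>\<^bsub>presented_group R\<^esub>"
    by (simp add: presented_group_one pres_class_eq_iff pres_eq_inv_word)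
  then show "\<exists>Q\<in>carrier (presented_group R). Q \<otimes>\<^bsub>presented_group R\<^esub> P = \<one>\<^bsub>presented_group R\<^esub>"
    by (auto simp: presented_group_carrier)
qed (auto simp: presented_group_carrier presented_group_one)


section \<open>Word metric and cone types\<close>

definition sym_gens :: "('a, 'b) monoid_scheme \<Rightarrow> 'a set \<Rightarrow> 'a set" where
  "sym_gens G X = X \<union> m_inv G ` X"

text \<open>Only meaningful if \<open>X\<close> generates \<open>G\<close>; otherwise the minimum may range over the empty set.\<close>

definition word_length :: "('a, 'b) monoid_scheme \<Rightarrow> 'a set \<Rightarrow> 'a \<Rightarrow> nat" where
  "word_length G X g =
    (LEAST n. \<exists>xs. set xs \<subseteq> sym_gens G X \<and> length xs = n \<and> foldr (mult G) xs \<one>\<^bsub>G\<^esub> = g)"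

definition word_dist :: "('a, 'b) monoid_scheme \<Rightarrow> 'a set \<Rightarrow> 'a \<Rightarrow> 'a \<Rightarrow> nat" where
  "word_dist G X g h = word_length G X (inv\<^bsub>G\<^esub> g \<otimes>\<^bsub>G\<^esub> h)"

definition cayley_adj :: "('a, 'b) monoid_scheme \<Rightarrow> 'a set \<Rightarrow> 'a \<Rightarrow> 'a \<Rightarrow> bool" where
  "cayley_adj G X g h \<longleftrightarrow> g \<in> carrier G \<and> (\<exists>x\<in>sym_gens G X. h = g \<otimes>\<^bsub>G\<^esub> x)"

text \<open>Edge paths are given by their nonempty sequences of vertices.\<close>

definition cayley_path :: "('a, 'b) monoid_scheme \<Rightarrow> 'a set \<Rightarrow> 'a list \<Rightarrow> bool" where
  "cayley_path G X p \<longleftrightarrow> p \<noteq> [] \<and> set p \<subseteq> carrier G \<and> successively (cayley_adj G X) p"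

definition outbound :: "('a, 'b) monoid_scheme \<Rightarrow> 'a set \<Rightarrow> 'a list \<Rightarrow> bool" where
  "outbound G X p \<longleftrightarrow>
    cayley_path G X p \<and> sorted_wrt (<) (map (word_dist G X \<one>\<^bsub>G\<^esub>) p)"

definition cone :: "('a, 'b) monoid_scheme \<Rightarrow> 'a set \<Rightarrow> 'a \<Rightarrow> 'a list set" where
  "cone G X g = {p. outbound G X p \<and> hd p = g}"

definition cone_type :: "('a, 'b) monoid_scheme \<Rightarrow> 'a set \<Rightarrow> 'a \<Rightarrow> 'a list set" where
  "cone_type G X g = map (\<lambda>h. inv\<^bsub>G\<^esub> g \<otimes>\<^bsub>G\<^esub> h) ` cone G X g"


section \<open>The lamplighter groups\<close>

datatype lamp_gen = Gen_a | Gen_t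

definition lamp_conj :: "int \<Rightarrow> lamp_gen word" where
  "lamp_conj i = gen_power Gen_t i @ gen_power Gen_a 1 @ gen_power Gen_t (- i)"

definition lamp_relators :: "nat \<Rightarrow> lamp_gen word set" where
  "lamp_relators m =
    insert (gen_power Gen_a (int m)) {commutator_word (lamp_conj i) (lamp_conj j) | i j. True}"

definition lamplighter :: "nat \<Rightarrow> lamp_gen word set monoid" where
  "lamplighter m = presented_group (lamp_relators m)"

definition lamp_a :: "nat \<Rightarrow> lamp_gen word set" where
  "lamp_a m = pres_class (lamp_relators m) [(Gen_a, True)]"

definition lamp_t :: "nat \<Rightarrow> lamp_gen word set" where
  "lamp_t m = pres_class (lamp_relators m) [(Gen_t, True)]"

lemma group_lamplighter: "group (lamplighter m)"
  by (simp add: lamplighter_def group_presented_group)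

lemma lamplighter_generated:
  "generate (lamplighter m) {lamp_a m, lamp_t m} = carrier (lamplighter m)"
proof
  let ?G = "lamplighter m" and ?R = "lamp_relators m" and ?S = "{lamp_a m, lamp_t m}"
  interpret group ?G by (rule group_lamplighter)
  have S: "?S \<subseteq> carrier ?G"
    by (auto simp: lamplighter_def lamp_a_def lamp_t_def presented_group_carrier)
  then show "generate ?G ?S \<subseteq> carrier ?G"
    by (rule generate_incl)
  have pos: "pres_class ?R [(x, True)] \<in> ?S" for x
    by (cases x) (auto simp: lamp_a_def lamp_t_def)
  have inv: "pres_class ?R [(x, False)] = inv\<^bsub>?G\<^esub> (pres_class ?R [(x, True)])" for x
  proof (rule inv_equality[symmetric])
    show "pres_class ?R [(x, False)] \<otimes>\<^bsub>?G\<^esub> pres_class ?R [(x, True)] = \<one>\<^bsub>?G\<^esub>"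
      using pres_eq.cancel[of ?R "[]" x False "[]"]
      by (simp add: lamplighter_def presented_group_one pres_class_eq_iff)
  qed (auto simp: lamplighter_def presented_group_carrier)
  have letter: "pres_class ?R [y] \<in> generate ?G ?S" for y
  proof -
    obtain x b where "y = (x, b)" by fastforce
    then show ?thesis
      using generate.incl[OF pos[of x], of ?G] generate.inv[OF pos[of x], of ?G]
      by (cases b) (auto simp: inv)
  qed
  have "pres_class ?R w \<in> generate ?G ?S" for w
  proof (induction w)
    case Nil
    then show ?case
      using generate.one[of ?G ?S] by (simp add: lamplighter_def presented_group_one)
  next
    case (Cons y w)
    then show ?case
      using generate.eng[OF letter[of y] Cons.IH] by (simp add: lamplighter_def)
  qed
  then show "carrier ?G \<subseteq> generate ?G ?S"
    by (auto simp: lamplighter_def presented_group_carrier)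
qed

end

theory Submission
  imports Defs
begin

text \<open>Let \<open>g\<^sub>k = t a t\<^bsup>-(k+1)\<^esup>\<close>: the lamp at \<open>1\<close> is lit and the lamplighter stands at \<open>-k\<close>.
  If he now walks to \<open>-(k+1)\<close>, lights the lamp there and walks right, he moves away from the
  identity until he reaches \<open>0\<close>; one step later it would have been shorter to light the lamp at
  \<open>-(k+1)\<close> first. So the path \<open>t\<^sup>-\<^sup>1 a t\<^sup>n\<close> is outbound at \<open>g\<^sub>k\<close> for \<open>n = k + 1\<close> but not for
  \<open>n = k + 2\<close>, and the cone types of the \<open>g\<^sub>k\<close> are distinct. Lengths are bounded from below by
  the optimal tour that realises the states of only the two lamps at \<open>1\<close> and \<open>-(k+1)\<close>: this
  changes by at most one under multiplication by a generator.\<close>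

section \<open>Lengths and outbound paths in presented groups\<close>

definition pres_gens :: "'x word set \<Rightarrow> 'x word set set" where
  "pres_gens R = range (\<lambda>x. pres_class R [(x, True)])"

definition pres_length :: "'x word set \<Rightarrow> 'x word \<Rightarrow> nat" where
  "pres_length R w = word_length (presented_group R) (pres_gens R) (pres_class R w)"

lemma pres_class_in_carrier [simp]: "pres_class R w \<in> carrier (presented_group R)"
  by (simp add: presented_group_carrier)

lemma inv_pres_class:
  "inv\<^bsub>presented_group R\<^esub> (pres_class R w) = pres_class R (inv_word w)"
proof -
  interpret group "presented_group R" by (rule group_presented_group)
  show ?thesis
    by (rule inv_equality)
      (simp_all add: presented_group_one pres_class_eq_iff pres_eq_inv_word)
qed

lemma sym_gens_pres_gens:
  "sym_gens (presented_group R) (pres_gens R) = range (\<lambda>y. pres_class R [y])"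
proof -
  have "sym_gens (presented_group R) (pres_gens R) =
    range (\<lambda>x. pres_class R [(x, True)]) \<union> range (\<lambda>x. pres_class R [(x, False)])"
    by (simp add: sym_gens_def pres_gens_def image_image inv_pres_class inv_word_def)
  also have "\<dots> = range (\<lambda>y. pres_class R [y])"
  proof -
    have "pres_class R [(x, b)] \<in>
      range (\<lambda>x. pres_class R [(x, True)]) \<union> range (\<lambda>x. pres_class R [(x, False)])" for x b
      by (cases b) auto
    then show ?thesis by auto
  qed
  finally show ?thesis .
qed

lemma foldr_mult_pres_class:
  "foldr (mult (presented_group R)) (map (\<lambda>y. pres_class R [y]) w) \<one>\<^bsub>presented_group R\<^esub> =
    pres_class R w"
  by (induction w) (simp_all add: presented_group_one)

text \<open>A list of elements of \<open>sym_gens\<close> is the letterwise image of a word, so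
  lengths can be computed on words up to \<open>pres_eq\<close>.\<close>

lemma pres_length_eq_Least:
  "pres_length R w = (LEAST n. \<exists>v. pres_eq R v w \<and> length v = n)"
proof -
  have "(\<exists>xs. set xs \<subseteq> range (\<lambda>y. pres_class R [y]) \<and> length xs = n \<and>
      foldr (mult (presented_group R)) xs \<one>\<^bsub>presented_group R\<^esub> = pres_class R w)
    \<longleftrightarrow> (\<exists>v. pres_eq R v w \<and> length v = n)" (is "?L \<longleftrightarrow> ?R") for n
  proof
    assume ?L
    then obtain xs where xs: "set xs \<subseteq> range (\<lambda>y. pres_class R [y])" "length xs = n"
      "foldr (mult (presented_group R)) xs \<one>\<^bsub>presented_group R\<^esub> = pres_class R w"
      by blast
    from xs(1) have "xs \<in> lists (range (\<lambda>y. pres_class R [y]))" by auto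
    then obtain v where "xs = map (\<lambda>y. pres_class R [y]) v"
      unfolding lists_image by blast
    with xs(2,3) show ?R
      by (auto simp: foldr_mult_pres_class pres_class_eq_iff)
  next
    assume ?R
    then obtain v where "pres_eq R v w" "length v = n" by blast
    then show ?L
      by (intro exI[of _ "map (\<lambda>y. pres_class R [y]) v"])
        (auto simp: foldr_mult_pres_class pres_class_eq_iff)
  qed
  then show ?thesis
    by (simp add: pres_length_def word_length_def sym_gens_pres_gens)
qed

lemma pres_length_le: "pres_eq R v w \<Longrightarrow> pres_length R w \<le> length v"
  unfolding pres_length_eq_Least by (rule Least_le) blast

lemma pres_length_attained: "\<exists>v. pres_eq R v w \<and> length v = pres_length R w"
  unfolding pres_length_eq_Least
  by (rule LeastI_ex) (blast intro: pres_eq.refl)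

lemma word_dist_one_pres_class:
  "word_dist (presented_group R) (pres_gens R) \<one>\<^bsub>presented_group R\<^esub> (pres_class R w) =
    pres_length R w"
proof -
  interpret group "presented_group R" by (rule group_presented_group)
  show ?thesis by (simp add: word_dist_def pres_length_def)
qed

text \<open>The vertices of the path that starts at the class of \<open>w\<close> and spells
  \<open>u\<close>. With \<open>w = []\<close> it encodes the word \<open>u\<close> as a candidate
  element of a cone type.\<close>

definition prefix_path :: "'x word set \<Rightarrow> 'x word \<Rightarrow> 'x word \<Rightarrow> 'x word set list" where
  "prefix_path R w u = map (\<lambda>i. pres_class R (w @ take i u)) [0..<Suc (length u)]"

lemma cayley_path_prefix_path:
  "cayley_path (presented_group R) (pres_gens R) (prefix_path R w u)"
proof -
  have "successively (cayley_adj (presented_group R) (pres_gens R)) (prefix_path R w u)"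
    unfolding successively_conv_nth
  proof (intro allI impI)
    fix i assume "Suc i < length (prefix_path R w u)"
    then have i: "i < length u" by (simp add: prefix_path_def)
    have "pres_class R (w @ take (Suc i) u) =
      pres_class R (w @ take i u) \<otimes>\<^bsub>presented_group R\<^esub> pres_class R [u ! i]"
      using i by (simp add: take_Suc_conv_app_nth)
    then show "cayley_adj (presented_group R) (pres_gens R)
        (prefix_path R w u ! i) (prefix_path R w u ! Suc i)"
      using i unfolding cayley_adj_def sym_gens_pres_gens prefix_path_def
      by (force simp del: upt_Suc presented_group_mult split_paired_Ex)
  qed
  then show ?thesis
    by (auto simp: cayley_path_def prefix_path_def)
qed

text \<open>Left translation is injective on vertex lists, so \<open>prefix_path R w u\<close> is
  the only path in the cone that can translate to \<open>prefix_path R [] u\<close>. Transitivity of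
  \<open><\<close> reduces outboundness to consecutive vertices.\<close>

lemma prefix_path_in_cone_type_iff:
  "prefix_path R [] u \<in>
      cone_type (presented_group R) (pres_gens R) (pres_class R w) \<longleftrightarrow>
    (\<forall>i<length u. pres_length R (w @ take i u) < pres_length R (w @ take (Suc i) u))"
    (is "_ \<longleftrightarrow> ?incr")
proof -
  let ?G = "presented_group R" and ?S = "pres_gens R" and ?g = "pres_class R w"
  interpret group ?G by (rule group_presented_group)
  have transl: "map (\<lambda>h. ?g \<otimes>\<^bsub>?G\<^esub> h) (prefix_path R [] u) = prefix_path R w u"
    by (simp add: prefix_path_def)
  have untransl: "map (\<lambda>h. inv\<^bsub>?G\<^esub> ?g \<otimes>\<^bsub>?G\<^esub> h) (prefix_path R w u) = prefix_path R [] u"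
    unfolding transl[symmetric]
    by (simp add: prefix_path_def m_assoc[symmetric] del: upt_Suc presented_group_mult)
  have "p = prefix_path R w u"
    if "set p \<subseteq> carrier ?G" "map (\<lambda>h. inv\<^bsub>?G\<^esub> ?g \<otimes>\<^bsub>?G\<^esub> h) p = prefix_path R [] u" for p
  proof -
    have "map (\<lambda>h. ?g \<otimes>\<^bsub>?G\<^esub> (inv\<^bsub>?G\<^esub> ?g \<otimes>\<^bsub>?G\<^esub> h)) p = p"
      using that(1) by (intro map_idI) (auto simp: m_assoc[symmetric])
    moreover have "map (\<lambda>h. ?g \<otimes>\<^bsub>?G\<^esub> h) (map (\<lambda>h. inv\<^bsub>?G\<^esub> ?g \<otimes>\<^bsub>?G\<^esub> h) p) = prefix_path R w u"
      unfolding that(2) by (rule transl)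
    ultimately show ?thesis by (simp add: comp_def)
  qed
  then have "p = prefix_path R w u"
    if "p \<in> cone ?G ?S ?g" "map (\<lambda>h. inv\<^bsub>?G\<^esub> ?g \<otimes>\<^bsub>?G\<^esub> h) p = prefix_path R [] u" for p
    using that by (simp add: cone_def outbound_def cayley_path_def)
  with untransl have "prefix_path R [] u \<in> cone_type ?G ?S ?g \<longleftrightarrow> prefix_path R w u \<in> cone ?G ?S ?g"
    unfolding cone_type_def by (metis (no_types, lifting) imageE imageI)
  also have "\<dots> \<longleftrightarrow> sorted_wrt (<) (map (\<lambda>i. pres_length R (w @ take i u)) [0..<Suc (length u)])"
  proof -
    have "hd (prefix_path R w u) = ?g"
      by (simp add: prefix_path_def upt_rec)
    moreover have "map (word_dist ?G ?S \<one>\<^bsub>?G\<^esub>) (prefix_path R w u) =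
        map (\<lambda>i. pres_length R (w @ take i u)) [0..<Suc (length u)]"
      by (simp add: prefix_path_def word_dist_one_pres_class)
    ultimately show ?thesis
      by (simp add: cone_def outbound_def cayley_path_prefix_path del: upt_Suc)
  qed
  also have "\<dots> \<longleftrightarrow> ?incr"
    by (auto simp: successively_conv_sorted_wrt[symmetric] successively_conv_nth
        simp del: upt_Suc)
  finally show ?thesis .
qed

text \<open>The word \<open>u @ v @ inv_word u @ inv_word v @ v @ u\<close> becomes
  \<open>v @ u\<close> when the relator in front is deleted, and \<open>u @ v\<close> when
  \<open>inv_word (v @ u)\<close> cancels against \<open>v @ u\<close>.\<close>

lemma pres_eq_commute:
  assumes "commutator_word u v \<in> R"
  shows "pres_eq R (u @ v) (v @ u)"
proof -
  have "inv_word (v @ u) = inv_word u @ inv_word v"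
    by (simp add: inv_word_def)
  then have "pres_eq R ((u @ v) @ inv_word u @ inv_word v @ v @ u) (u @ v)"
    using pres_eq_append[OF pres_eq.refl pres_eq_inv_word[of R "v @ u"], of "u @ v"] by simp
  moreover have "pres_eq R ((u @ v) @ inv_word u @ inv_word v @ v @ u) (v @ u)"
    using pres_eq.relator[OF assms, of "[]" "v @ u"] by (simp add: commutator_word_def)
  ultimately show ?thesis by (blast intro: pres_eq.sym pres_eq.trans)
qed

section \<open>Lamp configurations\<close>

fun position :: "lamp_gen word \<Rightarrow> int" where
  "position [] = 0"
| "position ((Gen_a, b) # w) = position w"
| "position ((Gen_t, b) # w) = (if b then 1 else -1) + position w"

text \<open>Not reduced modulo \<open>m\<close>, hence the total exponent with which \<open>a\<close> is applied at a site.\<close>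

fun lamps :: "lamp_gen word \<Rightarrow> int \<Rightarrow> int" where
  "lamps [] i = 0"
| "lamps ((Gen_a, b) # w) i = (if i = 0 then (if b then 1 else -1) else 0) + lamps w i"
| "lamps ((Gen_t, b) # w) i = lamps w (i - (if b then 1 else -1))"

lemma position_append [simp]: "position (u @ v) = position u + position v"
  by (induction u rule: position.induct) simp_all

text \<open>Together with \<open>position_append\<close> this is the multiplication of the wreath
  product of Z by Z.\<close>

lemma lamps_append [simp]: "lamps (u @ v) i = lamps u i + lamps v (i - position u)"
  by (induction u i rule: lamps.induct) (simp_all add: algebra_simps)

lemma position_inv_word [simp]: "position (inv_word w) = - position w"
  by (induction w rule: position.induct) (simp_all add: inv_word_def)

lemma lamps_inv_word [simp]: "lamps (inv_word w) i = - lamps w (i + position w)"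
  by (induction w arbitrary: i rule: position.induct)
    (use position_inv_word in \<open>auto simp: inv_word_def algebra_simps\<close>)

lemma position_replicate_t [simp]:
  "position (replicate n (Gen_t, b)) = (if b then int n else - int n)"
  by (induction n) simp_all

lemma lamps_replicate_t [simp]: "lamps (replicate n (Gen_t, b)) i = 0"
  by (induction n arbitrary: i) simp_all

lemma position_replicate_a [simp]: "position (replicate n (Gen_a, b)) = 0"
  by (induction n) simp_all

lemma lamps_replicate_a [simp]:
  "lamps (replicate n (Gen_a, True)) i = (if i = 0 then int n else 0)"
  by (induction n) simp_all

lemma position_lamp_conj [simp]: "position (lamp_conj i) = 0"
  by (auto simp: lamp_conj_def gen_power_def)

text \<open>Each \<open>lamp_conj i\<close> ends at position 0, so \<open>lamps\<close> is additive
  on these words and cancels on their commutators; the power of \<open>a\<close> contributes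
  \<open>m\<close> at site 0.\<close>

lemma lamp_relators_trivial:
  assumes "r \<in> lamp_relators m"
  shows "position r = 0" "int m dvd lamps r i"
  using assms by (auto simp: lamp_relators_def commutator_word_def gen_power_def)

lemma pres_eq_invariant:
  assumes "pres_eq (lamp_relators m) u v"
  shows "position u = position v \<and> (\<forall>i. int m dvd lamps u i - lamps v i)"
  using assms
proof induction
  case (sym u v)
  then show ?case by (metis dvd_minus_iff minus_diff_eq)
next
  case (trans u v w)
  then show ?case by (metis dvd_add diff_add_cancel add_diff_eq)
next
  case (cancel u x b v)
  then show ?case by (cases x; cases b) auto
next
  case (relator r u v)
  then show ?case by (simp add: lamp_relators_trivial)
qed simp

section \<open>The lower bound for word lengths\<close>

text \<open>\<open>tour K r l p\<close> is the length of a shortest walk from \<open>0\<close> to \<open>p\<close> that visits \<open>1\<close> if \<open>r\<close>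
  holds and \<open>-K\<close> if \<open>l\<close> holds.\<close>

definition tour :: "int \<Rightarrow> bool \<Rightarrow> bool \<Rightarrow> int \<Rightarrow> int" where
  "tour K r l p =
    (if r \<and> l then min (K + 2 + \<bar>p + K\<bar>) (2 * K + 1 + \<bar>p - 1\<bar>)
     else if r then 1 + \<bar>p - 1\<bar>
     else if l then K + \<bar>p + K\<bar>
     else \<bar>p\<bar>)"

text \<open>A lamp that is nonzero modulo \<open>m\<close> is charged a single letter, whatever its
  value.\<close>

definition two_lamp_bound :: "nat \<Rightarrow> int \<Rightarrow> lamp_gen word \<Rightarrow> int" where
  "two_lamp_bound m K w =
    (let r = \<not> int m dvd lamps w 1; l = \<not> int m dvd lamps w (- K)
     in of_bool r + of_bool l + tour K r l (position w))"

lemma two_lamp_bound_pres_eq: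
  assumes "pres_eq (lamp_relators m) u v"
  shows "two_lamp_bound m K u = two_lamp_bound m K v"
proof -
  have "int m dvd lamps u i \<longleftrightarrow> int m dvd lamps v i" for i
    using pres_eq_invariant[OF assms] dvd_add_right_iff[of "int m" "lamps u i - lamps v i" "lamps v i"]
    by simp
  then show ?thesis
    using pres_eq_invariant[OF assms] by (simp add: two_lamp_bound_def)
qed

lemma two_lamp_bound_snoc:
  assumes "K > 0"
  shows "two_lamp_bound m K (w @ [y]) \<le> two_lamp_bound m K w + 1"
proof -
  consider b where "y = (Gen_t, b)" | b where "y = (Gen_a, b)"
    by (metis lamp_gen.exhaust surj_pair)
  then show ?thesis
  proof cases
    case 1
    \<comment> \<open>A letter \<open>t\<close> leaves the lamps alone, and \<open>tour\<close> is
      1-Lipschitz in its endpoint.\<close>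
    have "tour K r l (p + d) \<le> tour K r l p + 1" if "\<bar>d\<bar> \<le> 1" for r l p d
      using that by (cases r; cases l) (auto simp: tour_def)
    then show ?thesis by (simp add: two_lamp_bound_def 1 Let_def)
  next
    case 2
    \<comment> \<open>A letter \<open>a\<close> changes only the lamp at the current position. A
      walk ending there visits that site anyway, so \<open>tour\<close> keeps its value and only an
      \<open>of_bool\<close> summand can grow.\<close>
    consider "position w = 1" | "position w = - K" | "position w \<noteq> 1" "position w \<noteq> - K"
      by blast
    then show ?thesis
    proof cases
      case 1
      then show ?thesis
        using assms by (auto simp: two_lamp_bound_def 2 Let_def tour_def)
    next
      case 2
      then show ?thesis
        using assms \<open>y = _\<close> by (auto simp: two_lamp_bound_def Let_def tour_def)
    next
      case 3
      then show ?thesis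
        using 2 by (auto simp: two_lamp_bound_def Let_def)
    qed
  qed
qed

lemma two_lamp_bound_append:
  assumes "K > 0"
  shows "two_lamp_bound m K (w @ u) \<le> two_lamp_bound m K w + int (length u)"
proof (induction u rule: rev_induct)
  case (snoc y u)
  then show ?case
    using two_lamp_bound_snoc[OF assms, of m "w @ u" y] by simp
qed simp

lemma two_lamp_bound_le_pres_length:
  assumes "K > 0"
  shows "two_lamp_bound m K w \<le> int (pres_length (lamp_relators m) w)"
proof -
  obtain v where v: "pres_eq (lamp_relators m) v w" "length v = pres_length (lamp_relators m) w"
    using pres_length_attained by blast
  have "two_lamp_bound m K [] = 0"
    by (simp add: two_lamp_bound_def tour_def)
  then have "two_lamp_bound m K v \<le> int (length v)"
    using two_lamp_bound_append[OF assms, of m "[]" v] by simp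
  then show ?thesis
    using v two_lamp_bound_pres_eq by metis
qed

section \<open>Separating the cone types\<close>

definition base_word :: "nat \<Rightarrow> lamp_gen word" where
  "base_word k = [(Gen_t, True), (Gen_a, True)] @ replicate (k + 1) (Gen_t, False)"

definition probe_word :: "nat \<Rightarrow> lamp_gen word" where
  "probe_word n = [(Gen_t, False), (Gen_a, True)] @ replicate n (Gen_t, True)"

text \<open>The final position is 0, where with \<open>K = k + 1\<close> both orders of visiting the
  two lamps cost \<open>2 * K + 2\<close>; lighting them adds 2. Since \<open>m\<close> is at least
  2, a single \<open>a\<close> counts as lit.\<close>

lemma two_lamp_bound_base_probe:
  assumes "m \<ge> 2"
  shows "two_lamp_bound m (int k + 1) (base_word k @ probe_word (k + 1)) = 2 * int k + 6"
  using assms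
  by (auto simp: two_lamp_bound_def tour_def base_word_def probe_word_def)

text \<open>The full word has \<open>2 * k + 6\<close> letters, which equals its bound, so it is
  geodesic. Its prefixes are geodesic too, because the remaining letters raise the bound by at most
  one each.\<close>

lemma pres_length_base_probe:
  assumes "m \<ge> 2" "i \<le> k + 3"
  shows "pres_length (lamp_relators m) (base_word k @ take i (probe_word (k + 1))) = k + 3 + i"
    (is "pres_length ?R ?w = _")
proof (rule antisym)
  let ?K = "int k + 1"
  show "pres_length ?R ?w \<le> k + 3 + i"
    using pres_length_le[OF pres_eq.refl, of ?R ?w] assms(2)
    by (simp add: base_word_def probe_word_def)
  have "?w @ drop i (probe_word (k + 1)) = base_word k @ probe_word (k + 1)"
    by simp
  then have "2 * int k + 6 \<le> two_lamp_bound m ?K ?w + int (length (drop i (probe_word (k + 1))))"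
    using two_lamp_bound_append[of ?K m ?w "drop i (probe_word (k + 1))"]
      two_lamp_bound_base_probe[OF assms(1), of k] by simp
  also have "int (length (drop i (probe_word (k + 1)))) = int k + 3 - int i"
    using assms(2) by (simp add: probe_word_def)
  finally show "k + 3 + i \<le> pres_length ?R ?w"
    using two_lamp_bound_le_pres_length[of ?K m ?w] by linarith
qed

lemma pres_length_base_probe_shortcut:
  "pres_length (lamp_relators m) (base_word k @ probe_word (k + 2)) \<le> 2 * k + 5"
proof -
  let ?R = "lamp_relators m" and ?t = "(Gen_t, True)" and ?T = "(Gen_t, False)"
    and ?a = "(Gen_a, True)"
  let ?u = "lamp_conj 1" and ?v = "lamp_conj (- int (k + 1))"
  have u: "?u = [?t, ?a, ?T]"
    by (simp add: lamp_conj_def gen_power_def)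
  have v: "?v = replicate (k + 1) ?T @ [?a] @ replicate (k + 1) ?t"
    unfolding lamp_conj_def gen_power_def by (simp del: of_nat_Suc add: nat_add_distrib)
  \<comment> \<open>Regrouped as a product of two lamp conjugates followed by \<open>t\<close>.
    Swapping the conjugates lights the left lamp first, and the last \<open>t\<close> then cancels
    the return step of \<open>?u\<close>.\<close>
  have "base_word k @ probe_word (k + 2) =
      [?t, ?a] @ (replicate (k + 1) ?T @ [?T]) @ [?a] @ (replicate (k + 1) ?t @ [?t])"
    by (simp add: base_word_def probe_word_def replicate_append_same)
  also have "\<dots> = (?u @ ?v) @ [?t]"
    unfolding u v by (simp add: replicate_append_same)
  finally have eq: "base_word k @ probe_word (k + 2) = (?u @ ?v) @ [?t]" .
  have "commutator_word ?u ?v \<in> ?R"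
    unfolding lamp_relators_def by blast
  then have "pres_eq ?R ((?u @ ?v) @ [?t]) ((?v @ ?u) @ [?t])"
    by (intro pres_eq_append pres_eq_commute pres_eq.refl)
  moreover have "pres_eq ?R ((?v @ ?u) @ [?t]) (?v @ [?t, ?a])"
    using pres_eq.cancel[of ?R "?v @ [?t, ?a]" Gen_t False "[]"] by (simp add: u)
  ultimately have "pres_eq ?R (?v @ [?t, ?a]) (base_word k @ probe_word (k + 2))"
    unfolding eq by (blast intro: pres_eq.sym pres_eq.trans)
  note pres_length_le[OF this]
  also have "length (?v @ [?t, ?a]) = 2 * k + 5"
    unfolding v by simp
  finally show ?thesis .
qed

lemma take_probe_word: "i \<le> n + 2 \<Longrightarrow> n \<le> n' \<Longrightarrow> take i (probe_word n) = take i (probe_word n')"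
  by (auto simp: probe_word_def take_Cons min_def split: nat.splits)

lemma probe_in_cone_type_base:
  assumes "m \<ge> 2"
  defines "R \<equiv> lamp_relators m"
  shows "j \<le> k \<Longrightarrow> prefix_path R [] (probe_word (j + 1)) \<in>
      cone_type (presented_group R) (pres_gens R) (pres_class R (base_word k))"
    and "prefix_path R [] (probe_word (k + 2)) \<notin>
      cone_type (presented_group R) (pres_gens R) (pres_class R (base_word k))"
proof -
  assume "j \<le> k"
  then have "take i (probe_word (j + 1)) = take i (probe_word (k + 1))" if "i \<le> j + 3" for i
    using that \<open>j \<le> k\<close> by (intro take_probe_word) auto
  then have "pres_length R (base_word k @ take i (probe_word (j + 1))) = k + 3 + i"
    if "i \<le> j + 3" for i
    using that \<open>j \<le> k\<close> pres_length_base_probe[OF assms(1), of i k] by (simp add: R_def)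
  moreover have "length (probe_word (j + 1)) = j + 3"
    by (simp add: probe_word_def)
  ultimately show "prefix_path R [] (probe_word (j + 1)) \<in>
      cone_type (presented_group R) (pres_gens R) (pres_class R (base_word k))"
    by (simp add: prefix_path_in_cone_type_iff)
next
  \<comment> \<open>The last letter of the probe takes the length from \<open>2 * k + 6\<close> to
    at most \<open>2 * k + 5\<close>.\<close>
  have "pres_length R (base_word k @ take (k + 3) (probe_word (k + 2))) = 2 * k + 6"
    using pres_length_base_probe[OF assms(1), of "k + 3" k]
      take_probe_word[of "k + 3" "k + 1" "k + 2"] by (simp add: R_def)
  moreover have "pres_length R (base_word k @ take (Suc (k + 3)) (probe_word (k + 2))) \<le> 2 * k + 5"
    using pres_length_base_probe_shortcut[of m k] by (simp add: R_def probe_word_def)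
  moreover have "k + 3 < length (probe_word (k + 2))"
    by (simp add: probe_word_def)
  ultimately show "prefix_path R [] (probe_word (k + 2)) \<notin>
      cone_type (presented_group R) (pres_gens R) (pres_class R (base_word k))"
    unfolding prefix_path_in_cone_type_iff by force
qed

theorem corollary16:
  fixes m :: nat
  assumes "m \<ge> 2"
  shows "infinite {cone_type (lamplighter m) {lamp_a m, lamp_t m} g | g. g \<in> carrier (lamplighter m)}"
proof -
  let ?R = "lamp_relators m"
  define C where
    "C k = cone_type (presented_group ?R) (pres_gens ?R) (pres_class ?R (base_word k))" for k
  have UNIV_lamp_gen: "UNIV = {Gen_a, Gen_t}"
    using lamp_gen.exhaust by blast
  have gens: "{lamp_a m, lamp_t m} = pres_gens ?R"
    unfolding pres_gens_def UNIV_lamp_gen by (simp add: lamp_a_def lamp_t_def)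
  \<comment> \<open>The path of \<open>probe_word (j + 2)\<close> lies in \<open>C k\<close>, since
    \<open>j + 1 \<le> k\<close>, but not in \<open>C j\<close>.\<close>
  have "C j \<noteq> C k" if "j < k" for j k
    using probe_in_cone_type_base(1)[OF assms, of "j + 1" k]
      probe_in_cone_type_base(2)[OF assms, of j] that
    by (auto simp: C_def)
  then have "inj C"
    by (metis injI linorder_neqE_nat)
  then have "infinite (range C)"
    by (simp add: finite_image_iff)
  moreover have "range C \<subseteq>
      {cone_type (lamplighter m) {lamp_a m, lamp_t m} g | g. g \<in> carrier (lamplighter m)}"
    unfolding gens lamplighter_def by (auto simp: C_def)
  ultimately show ?thesis
    using infinite_super by blast
qed

end
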